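(* Let $(a_n)_{n\ge1}$ be a periodic E-sequence, i.e. there are integers $l\ge0$, $r\ge1$ with $a_n=a_{n+r}$ for all $n>l$, and let $s=a_{l+1}+a_{l+2}+\cdots+a_{l+r}$. If $3^r>2^s$, then $(a_n)$ is $\Omega$-divergent.
   Context: An E-sequence is any infinite sequence $(a_n)_{n\ge1}$ of positive integers. For an odd positive integer $x$, its E-sequence $(a_n)_{n\ge1}$ is defined by $x_0=x$ and, for $n\ge1$, $x_n=\frac{3x_{n-1}+1}{2^{a_n}}$, where $a_n$ is the exponent of the largest power of $2$ dividing $3x_{n-1}+1$. An E-sequence is $\Omega$-divergent if it is not the E-sequence of any odd positive integer. *)

theory Defs
  imports "HOL-Computational_Algebra.Computational_Algebra"
begin

text \<open>Sequences \<open>(a\<^sub>n)\<close> with \<open>n \<ge> 1\<close> are functions on \<^typ>\<open>nat\<close> whose value at \<open>0\<close> is irrelevant.\<close>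

definition E_sequence :: "(nat \<Rightarrow> nat) \<Rightarrow> bool" where
  "E_sequence a \<longleftrightarrow> (\<forall>n\<ge>1. a n > 0)"

text \<open>The division below is exact, since the multiplicity is the exponent of the largest
  power of \<open>2\<close> dividing the numerator.\<close>

primrec odd_iterate :: "nat \<Rightarrow> nat \<Rightarrow> nat" where
  "odd_iterate x 0 = x"
| "odd_iterate x (Suc n) =
     (3 * odd_iterate x n + 1) div 2 ^ multiplicity 2 (3 * odd_iterate x n + 1)"

definition E_sequence_of :: "nat \<Rightarrow> nat \<Rightarrow> nat" where
  "E_sequence_of x n = multiplicity 2 (3 * odd_iterate x (n - 1) + 1)"

definition Omega_divergent :: "(nat \<Rightarrow> nat) \<Rightarrow> bool" where
  "Omega_divergent a \<longleftrightarrow> \<not> (\<exists>x. odd x \<and> x > 0 \<and> (\<forall>n\<ge>1. a n = E_sequence_of x n))"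

end

theory Submission
  imports Defs
begin

text \<open>Over one period the iteration is an affine map \<open>2\<^sup>s y' = 3\<^sup>r y + c\<close> whose constant
  \<open>c\<close> depends only on the exponents, hence is the same for every period. With
  \<open>D = 3\<^sup>r - 2\<^sup>s > 0\<close> the positive integer \<open>z = D y + c\<close> satisfies \<open>2\<^sup>s z' = 3\<^sup>r z\<close>, so the
  first such \<open>z\<close> would be divisible by every power of \<open>2\<^sup>s\<close>.\<close>

text \<open>Clears the denominator, so that later arguments use only this multiplicative form and
  never unfold \<open>div\<close>.\<close>

lemma odd_iterate_Suc_mult:
  "2 ^ E_sequence_of x (Suc n) * odd_iterate x (Suc n) = 3 * odd_iterate x n + 1"
  by (simp add: E_sequence_of_def multiplicity_dvd)

lemma odd_iterate_pos: "x > 0 \<Longrightarrow> odd_iterate x n > 0"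
proof (cases n)
  case (Suc m)
  have "2 ^ E_sequence_of x (Suc m) * odd_iterate x (Suc m) > 0"
    unfolding odd_iterate_Suc_mult by simp
  with Suc show ?thesis by (simp del: odd_iterate.simps)
qed simp

text \<open>The order of quantifiers matters: \<open>c\<close> is fixed before \<open>x\<close>, so
  a single constant serves all periods. One more step replaces \<open>c\<close> by
  \<open>3 * c + 2 ^ (\<Sum>i<r. b i)\<close>.\<close>

lemma affine_composition:
  fixes b :: "nat \<Rightarrow> nat"
  shows "\<exists>c. \<forall>x :: nat \<Rightarrow> nat. (\<forall>n<r. 2 ^ b n * x (Suc n) = 3 * x n + 1) \<longrightarrow>
           2 ^ (\<Sum>i<r. b i) * x r = 3 ^ r * x 0 + c"
proof (induction r)
  case (Suc r)
  then obtain c where c: "\<And>x :: nat \<Rightarrow> nat. \<forall>n<r. 2 ^ b n * x (Suc n) = 3 * x n + 1 \<Longrightarrow>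
      2 ^ (\<Sum>i<r. b i) * x r = 3 ^ r * x 0 + c"
    by blast
  have "2 ^ (\<Sum>i<Suc r. b i) * x (Suc r) = 3 ^ Suc r * x 0 + (3 * c + 2 ^ (\<Sum>i<r. b i))"
    if x: "\<forall>n<Suc r. 2 ^ b n * x (Suc n) = 3 * x n + 1" for x :: "nat \<Rightarrow> nat"
  proof -
    have "2 ^ (\<Sum>i<Suc r. b i) * x (Suc r) = 2 ^ (\<Sum>i<r. b i) * (2 ^ b r * x (Suc r))"
      by (simp add: power_add)
    also have "\<dots> = 3 * (2 ^ (\<Sum>i<r. b i) * x r) + 2 ^ (\<Sum>i<r. b i)"
      using x by (simp add: algebra_simps)
    also have "2 ^ (\<Sum>i<r. b i) * x r = 3 ^ r * x 0 + c"
      using x by (intro c) simp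
    finally show ?thesis by simp
  qed
  then show ?case by blast
qed simp

text \<open>Iterating gives \<open>p ^ k * z k = q ^ k * z 0\<close>, so by coprimality
  \<open>p ^ k\<close> divides \<open>z 0\<close> for every \<open>k\<close>. If \<open>z 0\<close>
  is nonzero, \<open>k = z 0\<close> is already too large, since
  \<open>p ^ k \<ge> 2 ^ k > k\<close>.\<close>

lemma coprime_geometric_eq_0:
  fixes z :: "nat \<Rightarrow> nat"
  assumes "coprime p q" "p \<ge> 2" and step: "\<And>k. p * z (Suc k) = q * z k"
  shows "z 0 = 0"
proof (rule ccontr)
  assume "z 0 \<noteq> 0"
  have "p ^ k * z k = q ^ k * z 0" for k
  proof (induction k)
    case (Suc k)
    have "p ^ Suc k * z (Suc k) = p ^ k * (p * z (Suc k))" by simp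
    also have "\<dots> = q * (p ^ k * z k)" by (simp add: step)
    finally show ?case by (simp add: Suc.IH)
  qed simp
  then have "p ^ z 0 dvd q ^ z 0 * z 0" by (metis dvd_triv_left)
  moreover have "coprime (p ^ z 0) (q ^ z 0)" using assms(1) by simp
  ultimately have "p ^ z 0 dvd z 0" by (simp add: coprime_dvd_mult_right_iff)
  with \<open>z 0 \<noteq> 0\<close> have "p ^ z 0 \<le> z 0" by (simp add: dvd_imp_le)
  moreover have "2 ^ z 0 \<le> p ^ z 0" using assms(2) by (simp add: power_mono)
  ultimately show False using less_exp[of "z 0"] by linarith
qed

theorem theorem3p4:
  fixes a :: "nat \<Rightarrow> nat" and l r s :: nat
  assumes "E_sequence a"
    and "r \<ge> 1"
    and "\<And>n. n > l \<Longrightarrow> a n = a (n + r)"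
    and "s = (\<Sum>i = l + 1..l + r. a i)"
    and "(3::nat) ^ r > 2 ^ s"
  shows "Omega_divergent a"
  unfolding Omega_divergent_def
proof
  assume "\<exists>x. odd x \<and> x > 0 \<and> (\<forall>n\<ge>1. a n = E_sequence_of x n)"
  then obtain x where "x > 0" and a: "\<And>n. n \<ge> 1 \<Longrightarrow> a n = E_sequence_of x n"
    by blast
  \<comment> \<open>Exponent number \<open>l + 1\<close> leads from iterate \<open>l\<close> to
    iterate \<open>l + 1\<close>, so \<open>b\<close>, indexed from 0, lists one period of exponents
    and \<open>y k\<close> is the iterate just before period \<open>k\<close>.\<close>
  define b where "b n = a (l + Suc n)" for n
  define y where "y k = odd_iterate x (l + k * r)" for k
  define D :: nat where "D = 3 ^ r - 2 ^ s"
  \<comment> \<open>The growth condition keeps the natural subtraction from truncating.\<close>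
  have D: "3 ^ r = D + 2 ^ s" "D > 0" using assms(5) by (simp_all add: D_def)
  have period: "a (l + k * r + Suc n) = b n" for k n
  proof (induction k)
    case (Suc k)
    then show ?case
      using assms(3)[of "l + k * r + Suc n"] by (simp add: algebra_simps)
  qed (simp add: b_def)
  have s: "s = (\<Sum>i<r. b i)"
    unfolding assms(4) b_def
    by (rule sum.reindex_bij_witness[of _ "\<lambda>i. l + Suc i" "\<lambda>i. i - Suc l"]) auto
  obtain c where c: "\<And>x :: nat \<Rightarrow> nat. \<forall>n<r. 2 ^ b n * x (Suc n) = 3 * x n + 1 \<Longrightarrow>
      2 ^ s * x r = 3 ^ r * x 0 + c"
    using affine_composition[of r b] unfolding s by blast
  have y: "2 ^ s * y (Suc k) = 3 ^ r * y k + c" for k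
  proof -
    have "2 ^ b n * odd_iterate x (l + k * r + Suc n) = 3 * odd_iterate x (l + k * r + n) + 1" for n
      using odd_iterate_Suc_mult[of x "l + k * r + n"] a[of "l + k * r + Suc n"] period[of k n]
      by (simp del: odd_iterate.simps)
    then show ?thesis
      using c[of "\<lambda>n. odd_iterate x (l + k * r + n)"] by (simp add: y_def add_ac)
  qed
  \<comment> \<open>The rational fixed point of the affine map is \<open>- c / D\<close>. Measuring
    \<open>y k\<close> from it makes the map linear, and the factor \<open>D\<close> keeps the
    values integral.\<close>
  have "2 ^ s * (D * y (Suc k) + c) = 3 ^ r * (D * y k + c)" for k
  proof -
    have "2 ^ s * (D * y (Suc k) + c) = D * (2 ^ s * y (Suc k)) + 2 ^ s * c"
      by (simp add: algebra_simps)
    also have "\<dots> = 3 ^ r * (D * y k) + (D + 2 ^ s) * c"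
      unfolding y by (simp add: algebra_simps)
    finally show ?thesis by (simp add: D(1)[symmetric] algebra_simps)
  qed
  moreover have "coprime (2 ^ s :: nat) (3 ^ r)" by simp
  \<comment> \<open>For \<open>s = 0\<close> the powers of \<open>2 ^ s\<close> would give no
    divisibility; a nonempty period of positive exponents excludes this.\<close>
  moreover have "(2 ^ s :: nat) \<ge> 2"
  proof -
    have "b 0 > 0" using assms(1) by (simp add: E_sequence_def b_def)
    moreover have "b 0 \<le> s" unfolding s using assms(2) by (intro member_le_sum) auto
    ultimately show ?thesis using self_le_power[of "2::nat" s] by simp
  qed
  ultimately have "D * y 0 + c = 0"
    using coprime_geometric_eq_0[of "2 ^ s" "3 ^ r" "\<lambda>k. D * y k + c"] by blast
  with D(2) odd_iterate_pos[OF \<open>x > 0\<close>, of l] show False by (simp add: y_def)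
qed

end
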